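(* Let $P$ be a poset with inconsistent pairs (PIP). For each $x \in P$, let $P_x$ be the sub-PIP $$P_x := \{\, y \in P : y \text{ is consistent and incomparable with } x \,\} \subseteq P,$$ and let $H_x := \square_{P_x}$ be the corresponding $\mathrm{CAT}(0)$ cubical complex. Then the derivative complex $D(\square_P)$ is (isomorphic, as a poset, to) the disjoint union over $x \in P$ of the face posets of the complexes $H_x$ (elements of different components being incomparable).
   Context: A poset with inconsistent pairs (PIP) is a triple $(P,\le,\nleftrightarrow)$ where $(P,\le)$ is a finite poset and $\nleftrightarrow$ is an irreflexive symmetric relation on $P$ such that $a \nleftrightarrow b$, $a \le a'$, $b \le b'$ imply $a' \nleftrightarrow b'$. Elements $a,b$ with $a\nleftrightarrow b$ are inconsistent; otherwise they are consistent. A subset is consistent if it contains no inconsistent pair. A sub-PIP is a subset with the restricted relations. A downset is a subset $I$ such that $a \in I$, $a' \le a$ imply $a' \in I$; $\max I$ is the set of maximal elements of $I$. The cubical complex $\square_P$ of a PIP $P$ has as vertices the consistent downsets of $P$, and has a face $C(I,M) := \{\, I \setminus N : N \subseteq M \,\}$ (a set of vertices, of dimension $|M|$) for each pair $(I,M)$ with $I$ a consistent downset and $M \subseteq \max I$; faces are ordered by inclusion (the empty set is not a face). It is known to be a $\mathrm{CAT}(0)$ cubical complex. For a cubical complex $\square$ (a collection of non-empty vertex sets, ordered by inclusion), the derivative complex $D\square$ is the poset whose elements are the sets $\{b,c\}$ where $b$ and $c$ are faces of $\square$ which have no meet in the face poset of $\square$ (the empty set is not counted as a face) but which are both covered by a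 common face; the order is $\{b,c\} \preceq \{b',c'\}$ iff ($b\subseteq b'$ and $c \subseteq c'$) or ($b \subseteq c'$ and $c \subseteq b'$). *)

theory Defs
  imports Main
begin

record 'a pip =
  elems :: "'a set"
  leq :: "'a rel"
  incon :: "'a rel"

definition is_pip :: "'a pip \<Rightarrow> bool" where
  "is_pip P \<longleftrightarrow>
     finite (elems P) \<and>
     partial_order_on (elems P) (leq P) \<and>
     incon P \<subseteq> elems P \<times> elems P \<and>
     irrefl (incon P) \<and>
     sym (incon P) \<and>
     (\<forall>a b a' b'. (a, b) \<in> incon P \<longrightarrow> (a, a') \<in> leq P \<longrightarrow> (b, b') \<in> leq P \<longrightarrow>
        (a', b') \<in> incon P)"

definition consistent :: "'a pip \<Rightarrow> 'a set \<Rightarrow> bool" where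
  "consistent P S \<longleftrightarrow> (\<forall>a\<in>S. \<forall>b\<in>S. (a, b) \<notin> incon P)"

definition downset :: "'a pip \<Rightarrow> 'a set \<Rightarrow> bool" where
  "downset P I \<longleftrightarrow> I \<subseteq> elems P \<and> (\<forall>a\<in>I. \<forall>a'. (a', a) \<in> leq P \<longrightarrow> a' \<in> I)"

definition max_elems :: "'a pip \<Rightarrow> 'a set \<Rightarrow> 'a set" where
  "max_elems P I = {m \<in> I. \<forall>a\<in>I. (m, a) \<in> leq P \<longrightarrow> a = m}"

definition sub_pip :: "'a pip \<Rightarrow> 'a set \<Rightarrow> 'a pip" where
  "sub_pip P S = \<lparr>elems = S, leq = Restr (leq P) S, incon = Restr (incon P) S\<rparr>"

definition pip_at :: "'a pip \<Rightarrow> 'a \<Rightarrow> 'a pip" where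
  "pip_at P x = sub_pip P
     {y \<in> elems P. (x, y) \<notin> incon P \<and> (x, y) \<notin> leq P \<and> (y, x) \<notin> leq P}"

lemma is_pip_sub_pip:
  assumes "is_pip P" "S \<subseteq> elems P"
  shows "is_pip (sub_pip P S)"
proof -
  have po: "refl_on (elems P) (leq P)" "trans (leq P)" "antisym (leq P)"
    using assms(1) partial_order_onD unfolding is_pip_def by blast+
  have "refl_on S (Restr (leq P) S)"
    using po(1) assms(2) unfolding refl_on_def by blast
  moreover have "antisym (Restr (leq P) S)"
    using po(3) unfolding antisym_def by blast
  ultimately have "partial_order_on S (Restr (leq P) S)"
    unfolding partial_order_on_def preorder_on_def
    using trans_Restr[OF po(2)] by blast
  moreover have "finite S"
    using assms unfolding is_pip_def by (blast intro: finite_subset)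
  moreover have "irrefl (Restr (incon P) S)"
    using assms(1) unfolding is_pip_def irrefl_def by blast
  moreover have "sym (Restr (incon P) S)"
    using assms(1) unfolding is_pip_def sym_def by blast
  moreover have "\<forall>a b a' b'. (a, b) \<in> Restr (incon P) S \<longrightarrow> (a, a') \<in> Restr (leq P) S \<longrightarrow>
      (b, b') \<in> Restr (leq P) S \<longrightarrow> (a', b') \<in> Restr (incon P) S"
    using assms(1) unfolding is_pip_def by blast
  ultimately show ?thesis
    unfolding is_pip_def sub_pip_def pip.simps by blast
qed

lemma is_pip_pip_at: "is_pip P \<Longrightarrow> is_pip (pip_at P x)"
  unfolding pip_at_def by (rule is_pip_sub_pip) auto

text \<open>A cubical complex is given by its set of faces, each face being its set of vertices.\<close>

definition cube_face :: "'a set \<Rightarrow> 'a set \<Rightarrow> 'a set set" where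
  "cube_face I M = {I - N | N. N \<subseteq> M}"

definition cube_complex :: "'a pip \<Rightarrow> 'a set set set" where
  "cube_complex P =
     {cube_face I M | I M. downset P I \<and> consistent P I \<and> M \<subseteq> max_elems P I}"

definition has_meet :: "'v set set \<Rightarrow> 'v set \<Rightarrow> 'v set \<Rightarrow> bool" where
  "has_meet K b c \<longleftrightarrow>
     (\<exists>g\<in>K. g \<subseteq> b \<and> g \<subseteq> c \<and> (\<forall>h\<in>K. h \<subseteq> b \<longrightarrow> h \<subseteq> c \<longrightarrow> h \<subseteq> g))"

definition covered_by :: "'v set set \<Rightarrow> 'v set \<Rightarrow> 'v set \<Rightarrow> bool" where
  "covered_by K b d \<longleftrightarrow> b \<in> K \<and> d \<in> K \<and> b \<subset> d \<and> \<not> (\<exists>e\<in>K. b \<subset> e \<and> e \<subset> d)"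

definition derivative :: "'v set set \<Rightarrow> 'v set set set" where
  "derivative K =
     {{b, c} | b c. b \<in> K \<and> c \<in> K \<and> \<not> has_meet K b c \<and>
        (\<exists>d\<in>K. covered_by K b d \<and> covered_by K c d)}"

definition derivative_order :: "'v set set \<Rightarrow> 'v set set rel" where
  "derivative_order K =
     {(X, Y) \<in> derivative K \<times> derivative K.
        \<exists>b c b' c'. X = {b, c} \<and> Y = {b', c'} \<and>
          (b \<subseteq> b' \<and> c \<subseteq> c' \<or> b \<subseteq> c' \<and> c \<subseteq> b')}"

definition disjoint_union_order :: "'i set \<Rightarrow> ('i \<Rightarrow> 'v set set) \<Rightarrow> ('i \<times> 'v set) rel" where
  "disjoint_union_order A K =
     {((x, F), (y, G)) | x F y G. x \<in> A \<and> y \<in> A \<and> F \<in> K x \<and> G \<in> K y \<and> x = y \<and> F \<subseteq> G}"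

text \<open>
  The constant \<open>iso\<close> from the well-order library makes sense for arbitrary relations; by
  \<open>iso_iff2\<close> it says that the map is a bijection between the fields that
  preserves and reflects the relation.  By the next two lemmas, the fields are
  the intended carriers.
\<close>

lemma Field_derivative_order: "Field (derivative_order K) = derivative K"
proof
  show "Field (derivative_order K) \<subseteq> derivative K"
    unfolding Field_def derivative_order_def by blast
  show "derivative K \<subseteq> Field (derivative_order K)"
  proof
    fix X assume X: "X \<in> derivative K"
    then obtain b c where "X = {b, c}"
      unfolding derivative_def by blast
    with X have "(X, X) \<in> derivative_order K"
      unfolding derivative_order_def by auto
    then show "X \<in> Field (derivative_order K)"
      by (rule FieldI1)
  qed
qed

lemma Field_disjoint_union_order: "Field (disjoint_union_order A K) = Sigma A K"
  unfolding Field_def disjoint_union_order_def by blast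

end

theory Submission
  imports Defs
begin

text \<open>
  A face \<open>C(I, M)\<close> is the order interval \<open>{I - M..I}\<close> of vertices. Two faces meet iff they
  intersect, so an element of the derivative complex is a pair of opposite facets of a cube
  \<open>{A..I}\<close>; such a pair splits the cube according to whether a vertex contains some fixed
  \<open>x \<in> I - A\<close>. As \<open>x\<close> is maximal in the consistent downset \<open>I\<close>, the set \<open>I\<close> is the union of the
  principal downset of \<open>x\<close> and of a consistent downset of \<open>P\<^sub>x\<close>. Hence the pair is obtained from
  a unique face of \<open>H\<^sub>x\<close> by adjoining to all of its vertices the principal downset of \<open>x\<close>, with
  and without \<open>x\<close>.
\<close>

section \<open>Faces as intervals of vertices\<close>

text \<open>A face is recorded by its bottom vertex \<open>A\<close> and its top vertex
  \<open>I\<close> instead of by \<open>I\<close> and \<open>M = I - A\<close>, so that inclusion of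
  faces becomes comparison of endpoints.\<close>

definition cell :: "'a pip \<Rightarrow> 'a set \<Rightarrow> 'a set \<Rightarrow> bool" where
  "cell P A I \<longleftrightarrow> downset P I \<and> consistent P I \<and> A \<subseteq> I \<and> I - A \<subseteq> max_elems P I"

lemma cellD:
  assumes "cell P A I"
  shows "downset P I" "consistent P I" "A \<subseteq> I" "I - A \<subseteq> max_elems P I"
  using assms unfolding cell_def by auto

lemma cube_face_eq_interval:
  assumes "M \<subseteq> I"
  shows "cube_face I M = {I - M..I}"
proof
  show "cube_face I M \<subseteq> {I - M..I}"
    unfolding cube_face_def by auto
  show "{I - M..I} \<subseteq> cube_face I M"
  proof
    fix J assume "J \<in> {I - M..I}"
    then have "J = I - (I - J)" "I - J \<subseteq> M" by auto
    then show "J \<in> cube_face I M"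
      unfolding cube_face_def by blast
  qed
qed

lemma cube_complex_eq: "cube_complex P = {{A..I} | A I. cell P A I}"
proof (intro equalityI subsetI)
  fix F assume "F \<in> cube_complex P"
  then obtain I M where F: "F = cube_face I M" "downset P I" "consistent P I"
      "M \<subseteq> max_elems P I"
    unfolding cube_complex_def by blast
  then have M: "M \<subseteq> I"
    unfolding max_elems_def by blast
  have "I - (I - M) = M"
    using M by blast
  then have "cell P (I - M) I"
    using F unfolding cell_def by auto
  then show "F \<in> {{A..I} | A I. cell P A I}"
    using F(1) cube_face_eq_interval[OF M] by blast
next
  fix F assume "F \<in> {{A..I} | A I. cell P A I}"
  then obtain A I where F: "F = {A..I}" "cell P A I" by blast
  have "I - (I - A) = A"
    using cellD(3)[OF F(2)] by blast
  then have "F = cube_face I (I - A)"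
    using cube_face_eq_interval[of "I - A" I] F(1) by auto
  then show "F \<in> cube_complex P"
    using F(2) unfolding cube_complex_def cell_def by blast
qed

lemma cell_in_cube_complex: "cell P A I \<Longrightarrow> {A..I} \<in> cube_complex P"
  unfolding cube_complex_eq by blast

lemma cube_complexE:
  assumes "F \<in> cube_complex P"
  obtains A I where "F = {A..I}" "cell P A I"
  using assms unfolding cube_complex_eq by blast

lemma cube_complex_nonempty: "F \<in> cube_complex P \<Longrightarrow> F \<noteq> {}"
  by (auto elim!: cube_complexE dest: cellD(3))

text \<open>Since \<open>A \<subseteq> J\<close>, only maximal elements of \<open>I\<close> are
  missing from \<open>J\<close>, and nothing in \<open>J\<close> lies above them; so
  \<open>J\<close> is still a downset. Elements maximal in \<open>I\<close> stay maximal in the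
  smaller set \<open>J\<close>.\<close>

lemma cell_subinterval:
  assumes "cell P A I" "A \<subseteq> B" "B \<subseteq> J" "J \<subseteq> I"
  shows "cell P B J"
proof -
  note c = cellD[OF assms(1)]
  have "downset P J"
    unfolding downset_def
  proof (intro conjI ballI allI impI)
    show "J \<subseteq> elems P"
      using c(1) assms(4) unfolding downset_def by blast
    fix a a' assume a: "a \<in> J" "(a', a) \<in> leq P"
    then have "a' \<in> I" "a \<in> I"
      using c(1) assms(4) unfolding downset_def by blast+
    show "a' \<in> J"
    proof (rule ccontr)
      assume "a' \<notin> J"
      then have "a' \<in> max_elems P I"
        using \<open>a' \<in> I\<close> c(4) assms(2,3) by blast
      then show False
        using a \<open>a \<in> I\<close> \<open>a' \<notin> J\<close> unfolding max_elems_def by blast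
    qed
  qed
  moreover have "consistent P J"
    using c(2) assms(4) unfolding consistent_def by blast
  moreover have "J - B \<subseteq> max_elems P J"
    using c(4) assms unfolding max_elems_def by blast
  ultimately show ?thesis
    using assms unfolding cell_def by blast
qed

section \<open>Meets, coverings and the elements of the derivative\<close>

lemma cube_complex_Int:
  assumes "b \<in> cube_complex P" "c \<in> cube_complex P" "b \<inter> c \<noteq> {}"
  shows "b \<inter> c \<in> cube_complex P"
proof -
  obtain A I where b: "b = {A..I}" "cell P A I"
    using assms(1) by (rule cube_complexE)
  obtain B J where c: "c = {B..J}"
    using assms(2) by (rule cube_complexE)
  have eq: "b \<inter> c = {A \<union> B..I \<inter> J}"
    using b(1) c by auto
  then have "A \<union> B \<subseteq> I \<inter> J"
    using assms(3) by auto
  then have "cell P (A \<union> B) (I \<inter> J)"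
    by (intro cell_subinterval[OF b(2)]) auto
  then show ?thesis
    unfolding eq by (rule cell_in_cube_complex)
qed

text \<open>Faces are nonempty, so a meet supplies a common vertex; conversely a nonempty
  intersection is itself a face and hence the meet.\<close>

lemma has_meet_cube_complex:
  assumes "b \<in> cube_complex P" "c \<in> cube_complex P"
  shows "has_meet (cube_complex P) b c \<longleftrightarrow> b \<inter> c \<noteq> {}"
proof
  assume "has_meet (cube_complex P) b c"
  then obtain g where "g \<in> cube_complex P" "g \<subseteq> b" "g \<subseteq> c"
    unfolding has_meet_def by blast
  then show "b \<inter> c \<noteq> {}"
    using cube_complex_nonempty by blast
next
  assume "b \<inter> c \<noteq> {}"
  then show "has_meet (cube_complex P) b c"
    using cube_complex_Int[OF assms] unfolding has_meet_def
    by (intro bexI[of _ "b \<inter> c"]) auto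
qed

text \<open>The direction \<open>x\<close> cuts the cube into the vertices with and without
  \<open>x\<close>. Each half differs from the cube in one endpoint, and there only by the single
  element \<open>x\<close>, so no face fits strictly between.\<close>

lemma covered_by_halves:
  assumes "cell P A I" "x \<in> I - A"
  shows "covered_by (cube_complex P) {insert x A..I} {A..I}"
    and "covered_by (cube_complex P) {A..I - {x}} {A..I}"
proof -
  have AI: "A \<subseteq> I"
    using cellD(3)[OF assms(1)] .
  have K: "{A..I} \<in> cube_complex P" "{insert x A..I} \<in> cube_complex P"
      "{A..I - {x}} \<in> cube_complex P"
    using AI assms(2) by (auto intro!: cell_in_cube_complex cell_subinterval[OF assms(1)])
  have no: "\<not> (\<exists>e\<in>cube_complex P. {insert x A..I} \<subset> e \<and> e \<subset> {A..I})"
  proof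
    assume "\<exists>e\<in>cube_complex P. {insert x A..I} \<subset> e \<and> e \<subset> {A..I}"
    then obtain B J where e: "{insert x A..I} \<subset> {B..J}" "{B..J} \<subset> {A..I}"
      by (auto elim!: cube_complexE)
    have 1: "B \<subseteq> insert x A" "I \<subseteq> J"
      using e(1) AI assms(2) by (auto simp: psubset_eq)
    have 2: "A \<subseteq> B" "J \<subseteq> I"
      using e 1 AI assms(2) by (auto simp: psubset_eq)
    have "B = A \<or> B = insert x A"
      using 1 2 by blast
    then show False
      using e 1 2 by auto
  qed
  have no': "\<not> (\<exists>e\<in>cube_complex P. {A..I - {x}} \<subset> e \<and> e \<subset> {A..I})"
  proof
    assume "\<exists>e\<in>cube_complex P. {A..I - {x}} \<subset> e \<and> e \<subset> {A..I}"
    then obtain B J where e: "{A..I - {x}} \<subset> {B..J}" "{B..J} \<subset> {A..I}"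
      by (auto elim!: cube_complexE)
    \<comment> \<open>This makes the lower half nonempty, so that its inclusion in
      \<open>{B..J}\<close> constrains the endpoints.\<close>
    have "A \<subseteq> I - {x}"
      using AI assms(2) by auto
    then have 1: "B \<subseteq> A" "I - {x} \<subseteq> J"
      using e(1) by (auto simp: psubset_eq)
    have 2: "A \<subseteq> B" "J \<subseteq> I"
      using e 1 AI assms(2) by (auto simp: psubset_eq)
    have "J = I \<or> J = I - {x}"
      using 1 2 by blast
    then show False
      using e 1 2 by auto
  qed
  have "I - {x} \<notin> {insert x A..I}" "I - {x} \<in> {A..I}"
    using AI assms(2) by auto
  then have "{insert x A..I} \<noteq> {A..I}" by metis
  then have "{insert x A..I} \<subset> {A..I}" by auto
  then show "covered_by (cube_complex P) {insert x A..I} {A..I}"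
    unfolding covered_by_def using K no by blast
  have "I \<notin> {A..I - {x}}" "I \<in> {A..I}"
    using AI assms(2) by auto
  then have "{A..I - {x}} \<noteq> {A..I}" by metis
  then have "{A..I - {x}} \<subset> {A..I}" by auto
  then show "covered_by (cube_complex P) {A..I - {x}} {A..I}"
    unfolding covered_by_def using K no' by blast
qed

text \<open>A proper face has a larger bottom or a smaller top. Any element \<open>x\<close> of the
  difference places it inside one half in direction \<open>x\<close>; that half is a proper face
  too, so covering forces equality.\<close>

lemma covered_by_cell:
  assumes "covered_by (cube_complex P) b {A..I}" "cell P A I"
  obtains x where "x \<in> I - A" "b = {insert x A..I} \<or> b = {A..I - {x}}"
proof -
  have b: "b \<in> cube_complex P" "b \<subset> {A..I}"
    and no: "\<And>e. e \<in> cube_complex P \<Longrightarrow> b \<subset> e \<Longrightarrow> \<not> e \<subset> {A..I}"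
    using assms(1) unfolding covered_by_def by auto
  obtain B J where bBJ: "b = {B..J}" and BJ: "cell P B J"
    using b(1) by (rule cube_complexE)
  have s: "A \<subseteq> B" "J \<subseteq> I" "B \<subseteq> J"
    using b(2) bBJ cellD(3)[OF BJ] by (auto simp: psubset_eq)
  have ne: "A \<noteq> B \<or> J \<noteq> I"
    using b(2) bBJ by auto
  then consider x where "x \<in> B - A" | x where "x \<in> I - J"
    using s by blast
  then show ?thesis
  proof cases
    case 1
    then have x: "x \<in> I - A" and sub: "b \<subseteq> {insert x A..I}"
      using s bBJ by auto
    have "b = {insert x A..I}"
      using covered_by_halves(1)[OF assms(2) x] no sub unfolding covered_by_def by blast
    with x that show ?thesis by blast
  next
    case 2
    then have x: "x \<in> I - A" and sub: "b \<subseteq> {A..I - {x}}"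
      using s bBJ by auto
    have "b = {A..I - {x}}"
      using covered_by_halves(2)[OF assms(2) x] no sub unfolding covered_by_def by blast
    with x that show ?thesis by blast
  qed
qed

lemma derivative_cube_complex:
  "derivative (cube_complex P) =
     {{{insert x A..I}, {A..I - {x}}} | x A I. cell P A I \<and> x \<in> I - A}"
proof (intro equalityI subsetI)
  fix X assume "X \<in> derivative (cube_complex P)"
  then obtain b c d where X: "X = {b, c}" "b \<in> cube_complex P" "c \<in> cube_complex P"
      "\<not> has_meet (cube_complex P) b c" "d \<in> cube_complex P"
      "covered_by (cube_complex P) b d" "covered_by (cube_complex P) c d"
    unfolding derivative_def by blast
  obtain A I where d: "d = {A..I}" and cell: "cell P A I"
    using X(5) by (rule cube_complexE)
  have AI: "A \<subseteq> I"
    using cellD(3)[OF cell] .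
  obtain x where x: "x \<in> I - A" "b = {insert x A..I} \<or> b = {A..I - {x}}"
    using X(6) cell unfolding d by (rule covered_by_cell)
  obtain y where y: "y \<in> I - A" "c = {insert y A..I} \<or> c = {A..I - {y}}"
    using X(7) cell unfolding d by (rule covered_by_cell)
  have disj: "b \<inter> c = {}"
    using X(4) has_meet_cube_complex[OF X(2,3)] by simp
  have xA: "x \<in> I" "x \<notin> A" and yA: "y \<in> I" "y \<notin> A"
    using x(1) y(1) by auto
  \<comment> \<open>Halves that are not opposite share a vertex: two upper ones share
    \<open>I\<close>, two lower ones share \<open>A\<close>, and an upper one in direction
    \<open>x\<close> with a lower one in direction \<open>y \<noteq> x\<close> share
    \<open>insert x A\<close>.\<close>
  have "I \<notin> b \<inter> c" "A \<notin> b \<inter> c" "insert x A \<notin> b \<inter> c" "insert y A \<notin> b \<inter> c"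
    unfolding disj by simp_all
  then have "x = y \<and> {b, c} = {{insert x A..I}, {A..I - {x}}}"
    using x(2) y(2) xA yA AI by (elim disjE) (auto simp: subset_Diff_insert)
  then show "X \<in> {{{insert x A..I}, {A..I - {x}}} | x A I. cell P A I \<and> x \<in> I - A}"
    using X(1) x(1) cell by blast
next
  fix X assume "X \<in> {{{insert x A..I}, {A..I - {x}}} | x A I. cell P A I \<and> x \<in> I - A}"
  then obtain x A I where X: "X = {{insert x A..I}, {A..I - {x}}}"
      and cell: "cell P A I" and x: "x \<in> I - A"
    by blast
  note cov = covered_by_halves[OF cell x]
  then have K: "{insert x A..I} \<in> cube_complex P" "{A..I - {x}} \<in> cube_complex P"
    unfolding covered_by_def by auto
  have "{insert x A..I} \<inter> {A..I - {x}} = {}" by auto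
  then have "\<not> has_meet (cube_complex P) {insert x A..I} {A..I - {x}}"
    using has_meet_cube_complex[OF K] by simp
  then show "X \<in> derivative (cube_complex P)"
    unfolding derivative_def X using K cov cell_in_cube_complex[OF cell] by blast
qed

section \<open>Adjoining and removing a principal downset\<close>

definition below :: "'a pip \<Rightarrow> 'a \<Rightarrow> 'a set" where
  "below P x = {y. (y, x) \<in> leq P}"

text \<open>Candidate for the inverse of the isomorphism. The pair consists of the two facets,
  opposite in direction \<open>x\<close>, of a cube that is the product of \<open>F\<close> with an
  edge.\<close>

definition facets :: "'a pip \<Rightarrow> 'a \<times> 'a set set \<Rightarrow> 'a set set set" where
  "facets P = (\<lambda>(x, F). {(\<lambda>J. J \<union> below P x) ` F, (\<lambda>J. J \<union> (below P x - {x})) ` F})"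

lemma pip_at_simps:
  "elems (pip_at P x) =
     {y \<in> elems P. (x, y) \<notin> incon P \<and> (x, y) \<notin> leq P \<and> (y, x) \<notin> leq P}"
  "leq (pip_at P x) = Restr (leq P) (elems (pip_at P x))"
  "incon (pip_at P x) = Restr (incon P) (elems (pip_at P x))"
  unfolding pip_at_def sub_pip_def by simp_all

lemma image_Un_interval:
  fixes A I D :: "'a set"
  assumes "A \<subseteq> I"
  shows "(\<lambda>J. J \<union> D) ` {A..I} = {A \<union> D..I \<union> D}"
proof
  show "(\<lambda>J. J \<union> D) ` {A..I} \<subseteq> {A \<union> D..I \<union> D}" by auto
  show "{A \<union> D..I \<union> D} \<subseteq> (\<lambda>J. J \<union> D) ` {A..I}"
  proof
    fix J assume "J \<in> {A \<union> D..I \<union> D}"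
    \<comment> \<open>Cutting \<open>J\<close> down to \<open>I\<close> loses only elements of
      \<open>D\<close> and keeps all of \<open>A\<close>, as \<open>A \<subseteq> I\<close>.\<close>
    then have "J = (J \<inter> I) \<union> D" "J \<inter> I \<in> {A..I}"
      using assms by auto
    then show "J \<in> (\<lambda>J. J \<union> D) ` {A..I}" by (rule image_eqI)
  qed
qed

text \<open>Elements of \<open>P\<^sub>x\<close> are incomparable with \<open>x\<close>. Adjoining
  the principal downset to a vertex of \<open>H\<^sub>x\<close> can therefore be undone.\<close>

lemma below_disjoint: "elems (pip_at P x) \<inter> below P x = {}"
  unfolding pip_at_simps below_def by blast

lemma face_subset_elems: "F \<in> cube_complex (pip_at P x) \<Longrightarrow> J \<in> F \<Longrightarrow> J \<subseteq> elems (pip_at P x)"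
  by (fastforce elim!: cube_complexE dest!: cellD(1) simp: downset_def)

context
  fixes P :: "'a pip"
  assumes pip: "is_pip P"
begin

lemma
  shows leq_refl: "\<And>a. a \<in> elems P \<Longrightarrow> (a, a) \<in> leq P"
    and leq_trans: "\<And>a b c. (a, b) \<in> leq P \<Longrightarrow> (b, c) \<in> leq P \<Longrightarrow> (a, c) \<in> leq P"
    and leq_antisym: "\<And>a b. (a, b) \<in> leq P \<Longrightarrow> (b, a) \<in> leq P \<Longrightarrow> a = b"
    and leq_elems: "\<And>a b. (a, b) \<in> leq P \<Longrightarrow> a \<in> elems P \<and> b \<in> elems P"
    and incon_irrefl: "\<And>a. (a, a) \<notin> incon P"
    and incon_sym: "\<And>a b. (a, b) \<in> incon P \<Longrightarrow> (b, a) \<in> incon P"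
    and incon_elems: "\<And>a b. (a, b) \<in> incon P \<Longrightarrow> a \<in> elems P \<and> b \<in> elems P"
    and incon_mono: "\<And>a b a' b'. (a, b) \<in> incon P \<Longrightarrow> (a, a') \<in> leq P \<Longrightarrow> (b, b') \<in> leq P \<Longrightarrow>
          (a', b') \<in> incon P"
proof -
  have po: "partial_order_on (elems P) (leq P)"
    using pip unfolding is_pip_def by blast
  note d = partial_order_onD[OF po]
  show "\<And>a. a \<in> elems P \<Longrightarrow> (a, a) \<in> leq P"
    using d(1) by (rule refl_onD)
  show "\<And>a b c. (a, b) \<in> leq P \<Longrightarrow> (b, c) \<in> leq P \<Longrightarrow> (a, c) \<in> leq P"
    using d(2) by (rule transD)
  show "\<And>a b. (a, b) \<in> leq P \<Longrightarrow> (b, a) \<in> leq P \<Longrightarrow> a = b"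
    using d(3) by (rule antisymD)
  show "\<And>a b. (a, b) \<in> leq P \<Longrightarrow> a \<in> elems P \<and> b \<in> elems P"
    using po unfolding partial_order_on_def preorder_on_def by blast
  show "\<And>a. (a, a) \<notin> incon P"
    using pip unfolding is_pip_def irrefl_def by blast
  show "\<And>a b. (a, b) \<in> incon P \<Longrightarrow> (b, a) \<in> incon P"
    using pip unfolding is_pip_def by (meson symD)
  show "\<And>a b. (a, b) \<in> incon P \<Longrightarrow> a \<in> elems P \<and> b \<in> elems P"
    using pip unfolding is_pip_def by blast
  show "\<And>a b a' b'. (a, b) \<in> incon P \<Longrightarrow> (a, a') \<in> leq P \<Longrightarrow> (b, b') \<in> leq P \<Longrightarrow>
          (a', b') \<in> incon P"
    using pip unfolding is_pip_def by blast
qed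

context
  fixes x
  assumes x: "x \<in> elems P"
begin

lemma below_self: "x \<in> below P x"
  using leq_refl[OF x] unfolding below_def by simp

text \<open>The enlarged cube has the directions of the old one and the new direction
  \<open>x\<close>. Inconsistency with an element below \<open>x\<close> would propagate up to
  \<open>x\<close>, and incomparability with \<open>x\<close> keeps the old directions and
  \<open>x\<close> maximal.\<close>

lemma cell_extend:
  assumes "cell (pip_at P x) A I"
  shows "cell P (A \<union> (below P x - {x})) (I \<union> below P x)"
proof -
  note c = cellD[OF assms]
  have I: "I \<subseteq> elems (pip_at P x)"
    using c(1) unfolding downset_def by blast
  have "downset P (I \<union> below P x)"
    unfolding downset_def
  proof (intro conjI ballI allI impI)
    show "I \<union> below P x \<subseteq> elems P"
      using I leq_elems unfolding pip_at_simps below_def by blast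
    fix a a' assume a: "a \<in> I \<union> below P x" "(a', a) \<in> leq P"
    show "a' \<in> I \<union> below P x"
    proof (cases "a \<in> below P x \<or> a' \<in> below P x")
      case True
      then show ?thesis
        using a(2) leq_trans unfolding below_def by blast
    next
      case False
      then have "a \<in> I" using a(1) by blast
      have ax: "(x, a) \<notin> incon P" "(x, a) \<notin> leq P"
        using \<open>a \<in> I\<close> I unfolding pip_at_simps by auto
      \<comment> \<open>If \<open>a'\<close> were inconsistent with \<open>x\<close> or above it, so
        would be \<open>a\<close>. With \<open>a'\<close> not below \<open>x\<close>, it follows
        that \<open>a'\<close> lies in \<open>P\<^sub>x\<close>, where \<open>I\<close> is a
        downset.\<close>
      have "(x, a') \<notin> incon P"
        using ax(1) incon_mono[OF _ leq_refl[OF x] a(2)] by blast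
      moreover have "(x, a') \<notin> leq P"
        using ax(2) leq_trans[OF _ a(2)] by blast
      ultimately have "a' \<in> elems (pip_at P x)"
        using False leq_elems[OF a(2)] unfolding pip_at_simps below_def by blast
      then have "(a', a) \<in> leq (pip_at P x)"
        using a(2) \<open>a \<in> I\<close> I unfolding pip_at_simps(2) by blast
      then show ?thesis
        using c(1) \<open>a \<in> I\<close> unfolding downset_def by blast
    qed
  qed
  moreover have "consistent P (I \<union> below P x)"
  proof -
    have II: "(a, b) \<notin> incon P" if "a \<in> I" "b \<in> I" for a b
      using that c(2) I unfolding consistent_def pip_at_simps(3) by blast
    have BI: "(a, b) \<notin> incon P" if "a \<in> below P x" "b \<in> I" for a b
    proof
      assume "(a, b) \<in> incon P"
      then have "(x, b) \<in> incon P"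
        using that(1) incon_mono leq_refl incon_elems unfolding below_def by blast
      then show False
        using that(2) I unfolding pip_at_simps by blast
    qed
    have BB: "(a, b) \<notin> incon P" if "a \<in> below P x" "b \<in> below P x" for a b
      using that incon_mono incon_irrefl unfolding below_def by blast
    show ?thesis
      unfolding consistent_def using II BI BB incon_sym by blast
  qed
  moreover have "(I \<union> below P x) - (A \<union> (below P x - {x})) \<subseteq> max_elems P (I \<union> below P x)"
  proof
    fix m assume m: "m \<in> (I \<union> below P x) - (A \<union> (below P x - {x}))"
    have "a = m" if a: "a \<in> I \<union> below P x" "(m, a) \<in> leq P" for a
    proof (cases "m = x")
      case True
      then have "a \<notin> I"
        using a(2) I unfolding pip_at_simps by blast
      then show ?thesis
        using a True leq_antisym unfolding below_def by blast
    next
      case False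
      then have mI: "m \<in> I - A" using m by blast
      \<comment> \<open>Otherwise \<open>a\<close> would lie below \<open>x\<close>, and so would
        \<open>m\<close>.\<close>
      then have "a \<in> I"
        using a I leq_trans unfolding pip_at_simps below_def by blast
      then have "(m, a) \<in> leq (pip_at P x)"
        using mI a(2) I unfolding pip_at_simps(2) by blast
      then show ?thesis
        using mI c(4) \<open>a \<in> I\<close> unfolding max_elems_def by blast
    qed
    then show "m \<in> max_elems P (I \<union> below P x)"
      using m unfolding max_elems_def by blast
  qed
  ultimately show ?thesis
    using c(3) unfolding cell_def by blast
qed

text \<open>Converse of \<open>cell_extend\<close>. As \<open>x\<close> is maximal in the consistent
  set \<open>I\<close>, whatever in \<open>I\<close> is not below \<open>x\<close> belongs to
  \<open>P\<^sub>x\<close>. Elements strictly below \<open>x\<close> are not maximal in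
  \<open>I\<close>, so they are no directions of the cube and lie in \<open>A\<close>.\<close>

lemma cell_restrict:
  assumes "cell P A I" "x \<in> I - A"
  defines "Q \<equiv> elems (pip_at P x)"
  shows "cell (pip_at P x) (A \<inter> Q) (I \<inter> Q)"
    and "A = (A \<inter> Q) \<union> (below P x - {x})"
    and "I = (I \<inter> Q) \<union> below P x"
proof -
  note c = cellD[OF assms(1)]
  have xmax: "x \<in> max_elems P I"
    using c(4) assms(2) by blast
  have BI: "below P x \<subseteq> I"
    using c(1) assms(2) unfolding downset_def below_def by blast
  have IQ: "y \<in> Q" if "y \<in> I" "y \<notin> below P x" for y
  proof -
    have "(x, y) \<notin> leq P"
      using that xmax below_self unfolding max_elems_def by blast
    moreover have "(x, y) \<notin> incon P"
      using that(1) assms(2) c(2) unfolding consistent_def by blast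
    ultimately show ?thesis
      using that c(1) unfolding Q_def pip_at_simps downset_def below_def by blast
  qed
  have BA: "below P x - {x} \<subseteq> A"
  proof
    fix y assume y: "y \<in> below P x - {x}"
    then have "y \<notin> max_elems P I"
      using assms(2) unfolding max_elems_def below_def by blast
    then show "y \<in> A"
      using c(4) BI y by blast
  qed
  show "I = (I \<inter> Q) \<union> below P x"
    using BI IQ by blast
  show "A = (A \<inter> Q) \<union> (below P x - {x})"
    using BA IQ c(3) assms(2) by blast
  have "downset (pip_at P x) (I \<inter> Q)"
    using c(1) unfolding downset_def pip_at_simps(2) Q_def by blast
  moreover have "consistent (pip_at P x) (I \<inter> Q)"
    using c(2) unfolding consistent_def pip_at_simps(3) by blast
  moreover have "(I \<inter> Q) - (A \<inter> Q) \<subseteq> max_elems (pip_at P x) (I \<inter> Q)"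
    using c(4) unfolding max_elems_def pip_at_simps(2) by blast
  ultimately show "cell (pip_at P x) (A \<inter> Q) (I \<inter> Q)"
    using c(3) unfolding cell_def by blast
qed

text \<open>Because \<open>x\<close> lies outside \<open>P\<^sub>x\<close>, adjoining
  \<open>x\<close> raises the bottom \<open>A'\<close> by exactly \<open>x\<close>, and omitting it
  lowers the top \<open>I'\<close> by exactly \<open>x\<close>. This is the form of the pairs in
  \<open>derivative_cube_complex\<close>.\<close>

lemma facets_interval:
  assumes "cell (pip_at P x) A I"
  defines "A' \<equiv> A \<union> (below P x - {x})" and "I' \<equiv> I \<union> below P x"
  shows "facets P (x, {A..I}) = {{insert x A'..I'}, {A'..I' - {x}}}"
    and "x \<in> I' - A'"
proof -
  have I: "I \<subseteq> elems (pip_at P x)" and AI: "A \<subseteq> I"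
    using cellD[OF assms(1)] unfolding downset_def by auto
  then have xI: "x \<notin> I"
    using below_disjoint[of P x] below_self by blast
  then have "A \<union> below P x = insert x A'" "I \<union> (below P x - {x}) = I' - {x}"
    using below_self unfolding A'_def I'_def by auto
  then show "facets P (x, {A..I}) = {{insert x A'..I'}, {A'..I' - {x}}}"
    unfolding facets_def by (simp add: image_Un_interval[OF AI] A'_def I'_def)
  show "x \<in> I' - A'"
    using xI AI below_self unfolding A'_def I'_def by blast
qed

lemma facets_in_derivative:
  assumes "F \<in> cube_complex (pip_at P x)"
  shows "facets P (x, F) \<in> derivative (cube_complex P)"
proof -
  obtain A I where F: "F = {A..I}" and c: "cell (pip_at P x) A I"
    using assms by (rule cube_complexE)
  show ?thesis
    unfolding derivative_cube_complex F facets_interval(1)[OF c]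
    using facets_interval(2)[OF c] cell_extend[OF c] by blast
qed

end

end

section \<open>Surjectivity, order and the isomorphism\<close>

lemma derivative_subset_facets:
  assumes "is_pip P" "X \<in> derivative (cube_complex P)"
  shows "X \<in> facets P ` Sigma (elems P) (\<lambda>x. cube_complex (pip_at P x))"
proof -
  obtain x A I where X: "X = {{insert x A..I}, {A..I - {x}}}"
      and c: "cell P A I" and xI: "x \<in> I - A"
    using assms(2) unfolding derivative_cube_complex by (elim CollectE exE conjE)
  have x: "x \<in> elems P"
    using cellD(1)[OF c] xI unfolding downset_def by blast
  let ?Q = "elems (pip_at P x)"
  note r = cell_restrict[OF assms(1) x c xI]
  \<comment> \<open>The preimage is the cube restricted to \<open>P\<^sub>x\<close>; extending it
    again gives back \<open>A\<close> and \<open>I\<close>.\<close>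
  have "X = facets P (x, {A \<inter> ?Q..I \<inter> ?Q})"
    using facets_interval(1)[OF assms(1) x r(1)] X by (simp only: r(2,3)[symmetric])
  moreover have "(x, {A \<inter> ?Q..I \<inter> ?Q}) \<in> Sigma (elems P) (\<lambda>x. cube_complex (pip_at P x))"
    using x cell_in_cube_complex[OF r(1)] by (rule SigmaI)
  ultimately show ?thesis by (rule image_eqI)
qed

text \<open>The element \<open>y\<close> separates the two facets of \<open>(y, G)\<close>. A vertex
  of \<open>F\<close> yields two vertices differing only by \<open>x\<close>, one in each of these
  facets, which forces \<open>x = y\<close>; removing the principal downset then compares
  \<open>F\<close> with \<open>G\<close>.\<close>

lemma facets_order:
  assumes pip: "is_pip P" and x: "x \<in> elems P" and y: "y \<in> elems P"
    and F: "F \<in> cube_complex (pip_at P x)" and G: "G \<in> cube_complex (pip_at P y)"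
  shows "(facets P (x, F), facets P (y, G)) \<in> derivative_order (cube_complex P) \<longleftrightarrow>
           x = y \<and> F \<subseteq> G"
proof -
  let ?b = "\<lambda>x F. (\<lambda>J. J \<union> below P x) ` F"
  let ?c = "\<lambda>x F. (\<lambda>J. J \<union> (below P x - {x})) ` F"
  have eq: "facets P (x, F) = {?b x F, ?c x F}" for x F
    unfolding facets_def by simp
  note mem = facets_in_derivative[OF pip x F] facets_in_derivative[OF pip y G]
  show ?thesis
  proof
    assume "(facets P (x, F), facets P (y, G)) \<in> derivative_order (cube_complex P)"
    then obtain b c b' c'
      where bc: "facets P (x, F) = {b, c}" "facets P (y, G) = {b', c'}"
        and sub: "b \<subseteq> b' \<and> c \<subseteq> c' \<or> b \<subseteq> c' \<and> c \<subseteq> b'"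
      unfolding derivative_order_def by auto
    \<comment> \<open>Swapping the members of an unordered pair merely exchanges the two
      alternatives of \<open>sub\<close>.\<close>
    have cases: "?b x F \<subseteq> ?b y G \<and> ?c x F \<subseteq> ?c y G \<or> ?b x F \<subseteq> ?c y G \<and> ?c x F \<subseteq> ?b y G"
      using sub bc[unfolded eq doubleton_eq_iff] by (elim disjE conjE) simp_all
    have bmem: "y \<in> J" if "J \<in> ?b y G" for J
      using that below_self[OF pip y] by auto
    have cmem: "y \<notin> J" if "J \<in> ?c y G" for J
      using that below_self[OF pip y] below_disjoint[of P y] face_subset_elems[OF G]
      by blast
    obtain J where J: "J \<in> F"
      using cube_complex_nonempty[OF F] by blast
    then have Jb: "J \<union> below P x \<in> ?b x F" and Jc: "J \<union> (below P x - {x}) \<in> ?c x F"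
      by auto
    \<comment> \<open>A crossed inclusion would put \<open>y\<close> into the smaller of two nested
      vertices but not into the larger.\<close>
    have "\<not> (?b x F \<subseteq> ?c y G \<and> ?c x F \<subseteq> ?b y G)"
    proof
      assume s: "?b x F \<subseteq> ?c y G \<and> ?c x F \<subseteq> ?b y G"
      have "y \<notin> J \<union> below P x"
        using conjunct1[OF s] Jb by (intro cmem) (rule subsetD)
      moreover have "y \<in> J \<union> (below P x - {x})"
        using conjunct2[OF s] Jc by (intro bmem) (rule subsetD)
      ultimately show False by blast
    qed
    with cases have subs: "?b x F \<subseteq> ?b y G" "?c x F \<subseteq> ?c y G" by argo+
    have "y \<in> J \<union> below P x"
      using subs(1) Jb by (intro bmem) (rule subsetD)
    moreover have "y \<notin> J \<union> (below P x - {x})"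
      using subs(2) Jc by (intro cmem) (rule subsetD)
    ultimately have xy: "x = y" by blast
    have "F \<subseteq> G"
    proof
      fix J assume J: "J \<in> F"
      then obtain J' where J': "J' \<in> G" "J \<union> below P x = J' \<union> below P x"
        using subs(1) xy by auto
      have "J \<inter> below P x = {}" "J' \<inter> below P x = {}"
        using J J'(1) xy face_subset_elems[OF F] face_subset_elems[OF G] below_disjoint[of P x]
        by blast+
      then have "J = J'"
        using J'(2) by blast
      then show "J \<in> G"
        using J'(1) by simp
    qed
    with xy show "x = y \<and> F \<subseteq> G" by simp
  next
    assume "x = y \<and> F \<subseteq> G"
    then have "?b x F \<subseteq> ?b y G \<and> ?c x F \<subseteq> ?c y G" by auto
    then show "(facets P (x, F), facets P (y, G)) \<in> derivative_order (cube_complex P)"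
      unfolding derivative_order_def using mem eq[of x F] eq[of y G]
      by (simp only: mem_Collect_eq case_prod_conv mem_Sigma_iff) metis
  qed
qed

theorem theorem5p4:
  fixes P :: "'a pip"
  assumes "is_pip P"
  shows "\<exists>f. iso (derivative_order (cube_complex P))
                 (disjoint_union_order (elems P) (\<lambda>x. cube_complex (pip_at P x))) f"
proof
  let ?S = "Sigma (elems P) (\<lambda>x. cube_complex (pip_at P x))"
  let ?D = "derivative (cube_complex P)"
  let ?R = "derivative_order (cube_complex P)"
  let ?U = "disjoint_union_order (elems P) (\<lambda>x. cube_complex (pip_at P x))"
  have ord: "(facets P p, facets P q) \<in> ?R \<longleftrightarrow> (p, q) \<in> ?U" if "p \<in> ?S" "q \<in> ?S" for p q
    using that facets_order[OF assms] unfolding disjoint_union_order_def by auto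
  have U_refl: "(p, p) \<in> ?U" if "p \<in> ?S" for p
    using that unfolding disjoint_union_order_def by auto
  have U_antisym: "p = q" if "(p, q) \<in> ?U" "(q, p) \<in> ?U" for p q
    using that unfolding disjoint_union_order_def by auto
  \<comment> \<open>Equal images are comparable both ways; \<open>ord\<close> transfers this to the
    disjoint union, where antisymmetry applies.\<close>
  have inj: "inj_on (facets P) ?S"
  proof (rule inj_onI)
    fix p q assume pq: "p \<in> ?S" "q \<in> ?S" "facets P p = facets P q"
    then have "(p, q) \<in> ?U" "(q, p) \<in> ?U"
      using ord U_refl by metis+
    then show "p = q" by (rule U_antisym)
  qed
  have img: "facets P ` ?S = ?D"
    using derivative_subset_facets[OF assms] facets_in_derivative[OF assms] by fast
  \<comment> \<open>The inverse is taken because the isomorphism is to run from the derivative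
    complex to the disjoint union.\<close>
  let ?f = "inv_into ?S (facets P)"
  have bij: "bij_betw ?f ?D ?S"
    using inj img by (intro bij_betw_inv_into) (simp add: bij_betw_def)
  show "iso ?R ?U ?f"
    unfolding iso_iff2 Field_derivative_order Field_disjoint_union_order
  proof (intro conjI ballI)
    show "bij_betw ?f ?D ?S" by (rule bij)
    fix X Y assume XY: "X \<in> ?D" "Y \<in> ?D"
    have "facets P (?f X) = X" "facets P (?f Y) = Y"
      using XY unfolding img[symmetric] by (simp_all only: f_inv_into_f)
    moreover have "?f X \<in> ?S" "?f Y \<in> ?S"
      using XY bij bij_betwE by blast+
    ultimately show "(X, Y) \<in> ?R \<longleftrightarrow> (?f X, ?f Y) \<in> ?U"
      using ord by metis
  qed
qed

end
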